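(* Let $d\ge 3$, $n\ge 1$ and $\ell\ge 1$ be integers, and let $r=r_2(d-1;\ell)$. Then $$r(K_d^3(n);\ell)\le 2^{\ell^{2r}n^2}.$$
   Context: For integers $k,m,\ell$, the $\ell$-color Ramsey number $r_k(m;\ell)$ is the minimum $N$ such that every $\ell$-coloring of the $k$-element subsets of an $N$-element set contains a subset of size $m$ all of whose $k$-element subsets have the same color; thus $r_2(d-1;\ell)$ is the $\ell$-color Ramsey number of the complete graph on $d-1$ vertices. For a $k$-uniform hypergraph $H$, $r(H;\ell)$ is the minimum $N$ such that every $\ell$-coloring of the $k$-element subsets of an $N$-element set contains a monochromatic copy of $H$ (i.e., a copy of $H$ on the vertex set all of whose edges receive the same color). The complete $d$-partite $3$-uniform hypergraph $K_d^3(n)$ has vertex set the disjoint union of $d$ parts each of size $n$, and its edges are all triples with vertices in three different parts. Floor and ceiling signs are omitted where not crucial.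
   Formalization: The theorem is proved for ℓ ≥ 2 instead of ℓ ≥ 1: for ℓ = 1 the Ramsey number is dn while the bound is 2^{n^2}, so the claim fails, e.g. for d = 3, n = 1 it would say 3 ≤ 2. *)

theory Defs
  imports "HOL-Library.Ramsey"
begin

text \<open>The least \<open>N\<close> such that every \<open>l\<close>-colouring of the \<open>k\<close>-subsets of an \<open>N\<close>-set
  has a monochromatic \<open>m\<close>-subset.\<close>

definition ramsey_number :: "nat \<Rightarrow> nat \<Rightarrow> nat \<Rightarrow> nat" where
  "ramsey_number k m l = (LEAST N. partn {..<N} m k {..<l})"

text \<open>A hypergraph is a pair of a vertex set and a set of edges; a copy of it in \<open>A\<close> is the image
  under an injection of the vertices into \<open>A\<close>.\<close>

type_synonym 'a hypergraph = "'a set \<times> 'a set set"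

definition monochromatic_copy ::
  "'a hypergraph \<Rightarrow> 'b set \<Rightarrow> ('b set \<Rightarrow> 'c) \<Rightarrow> 'c \<Rightarrow> bool" where
  "monochromatic_copy H A f c \<longleftrightarrow>
     (\<exists>\<phi>. inj_on \<phi> (fst H) \<and> \<phi> ` fst H \<subseteq> A \<and> (\<forall>e\<in>snd H. f (\<phi> ` e) = c))"

definition hypergraph_arrows :: "nat \<Rightarrow> 'a hypergraph \<Rightarrow> 'b set \<Rightarrow> nat \<Rightarrow> bool" where
  "hypergraph_arrows k H A l \<longleftrightarrow>
     (\<forall>f \<in> nsets A k \<rightarrow> {..<l}. \<exists>c<l. monochromatic_copy H A f c)"

definition hypergraph_ramsey :: "nat \<Rightarrow> 'a hypergraph \<Rightarrow> nat \<Rightarrow> nat" where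
  "hypergraph_ramsey k H l = (LEAST N. hypergraph_arrows k H {..<N} l)"

text \<open>Part \<open>i\<close> of the complete \<open>d\<close>-partite 3-uniform hypergraph is \<open>{i} \<times> {..<n}\<close>.\<close>

definition complete_multipartite3 :: "nat \<Rightarrow> nat \<Rightarrow> (nat \<times> nat) hypergraph" where
  "complete_multipartite3 d n =
     ({..<d} \<times> {..<n}, {e \<in> nsets ({..<d} \<times> {..<n}) 3. inj_on fst e})"

text \<open>Both minima are attained, so that \<open>LEAST\<close> is meaningful.\<close>

lemma ramsey_number_attained: "partn {..<ramsey_number k m l} m k {..<l}"
proof -
  obtain N :: nat where "partn_lst {..<N} (replicate l m) k"
    using ramsey_full by blast
  then have "partn {..<N} m k {..<l}"
    by (simp add: partn_lst_def partn_def Bex_def cong: conj_cong)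
  then show ?thesis
    unfolding ramsey_number_def by (rule LeastI)
qed

lemma partn_imp_hypergraph_arrows:
  assumes V: "finite (fst H)" and E: "snd H \<subseteq> nsets (fst H) k"
    and p: "partn A (card (fst H)) k {..<l}"
  shows "hypergraph_arrows k H A l"
  unfolding hypergraph_arrows_def
proof
  fix f assume "f \<in> nsets A k \<rightarrow> {..<l}"
  then obtain c M where c: "c < l" and M: "M \<in> nsets A (card (fst H))"
    and mono: "f ` nsets M k \<subseteq> {c}"
    using p unfolding partn_def monochromatic_def by blast
  obtain \<phi> where \<phi>: "bij_betw \<phi> (fst H) M"
    using V M finite_same_card_bij[of "fst H" M] unfolding nsets_def by auto
  have "f (\<phi> ` e) = c" if "e \<in> snd H" for e
  proof -
    have e: "e \<subseteq> fst H" "finite e" "card e = k"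
      using E that unfolding nsets_def by auto
    have "inj_on \<phi> e"
      using \<phi> e(1) unfolding bij_betw_def by (meson inj_on_subset)
    then have "\<phi> ` e \<in> nsets M k"
      using e \<phi> unfolding nsets_def bij_betw_def by (auto simp: card_image)
    then show ?thesis
      using mono by blast
  qed
  then have "monochromatic_copy H A f c"
    using \<phi> M unfolding monochromatic_copy_def bij_betw_def nsets_def by blast
  then show "\<exists>c<l. monochromatic_copy H A f c"
    using c by blast
qed

lemma hypergraph_ramsey_attained:
  assumes "finite (fst H)" "snd H \<subseteq> nsets (fst H) k"
  shows "hypergraph_arrows k H {..<hypergraph_ramsey k H l} l"
  unfolding hypergraph_ramsey_def
  by (rule LeastI[where k = "ramsey_number k (card (fst H)) l"])
     (rule partn_imp_hypergraph_arrows[OF assms ramsey_number_attained])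

lemma card_vertices_le_hypergraph_ramsey:
  assumes "finite (fst H)" "snd H \<subseteq> nsets (fst H) k" "l \<ge> 1"
  shows "card (fst H) \<le> hypergraph_ramsey k H l"
proof -
  have "(\<lambda>_. 0) \<in> nsets {..<hypergraph_ramsey k H l} k \<rightarrow> {..<l}"
    using assms(3) by auto
  then obtain c where
    "monochromatic_copy H {..<hypergraph_ramsey k H l} (\<lambda>_. 0::nat) c"
    using hypergraph_ramsey_attained[OF assms(1,2), of l]
    unfolding hypergraph_arrows_def by blast
  then obtain \<phi> where "inj_on \<phi> (fst H)" "\<phi> ` fst H \<subseteq> {..<hypergraph_ramsey k H l}"
    unfolding monochromatic_copy_def by blast
  then show ?thesis
    by (metis card_inj_on_le card_lessThan finite_lessThan)
qed

text \<open>With a single colour the Ramsey number of the hypergraph is at least its number \<open>d * n\<close> of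
  vertices, while \<open>2 ^ (l ^ (2 * r) * n\<^sup>2)\<close> is only \<open>2 ^ n\<^sup>2\<close>. The bound therefore needs \<open>l \<ge> 2\<close>.\<close>

lemma bound_fails_for_one_colour:
  "2 ^ (1 ^ (2 * ramsey_number 2 (3 - 1) 1) * 1\<^sup>2)
     < hypergraph_ramsey 3 (complete_multipartite3 3 1) 1"
proof -
  have "finite (fst (complete_multipartite3 3 1))"
    and "snd (complete_multipartite3 3 1) \<subseteq> nsets (fst (complete_multipartite3 3 1)) 3"
    and "card (fst (complete_multipartite3 3 1)) = 3"
    unfolding complete_multipartite3_def by auto
  then have "3 \<le> hypergraph_ramsey 3 (complete_multipartite3 3 1) 1"
    using card_vertices_le_hypergraph_ramsey[of "complete_multipartite3 3 1" 3 1] by simp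
  then show ?thesis
    by simp
qed

end

theory Submission
  imports Defs
begin

text \<open>
  A blown-up Erdos--Rado argument. One builds disjoint sets \<open>V\<^sub>0, \<dots>, V\<^sub>k\<^sub>-\<^sub>1\<close> of size
  \<open>n l\<^sup>r\<^sup>-\<^sup>k\<close> and a reservoir \<open>S\<close> such that the colour of a triple with vertices in
  \<open>V\<^sub>i\<close>, \<open>V\<^sub>j\<close> and in a later part or \<open>S\<close> depends only on \<open>i < j\<close>. To add a part, fix \<open>T \<subseteq> S\<close>
  of size exponential in \<open>n\<close>: every pair \<open>w \<in> T\<close>, \<open>s \<in> S - T\<close> picks in each \<open>V\<^sub>i\<close> a
  monochromatic subset with a proportion \<open>1/l\<close> of the elements; by pigeonhole many \<open>w\<close> pick
  the same subsets and colours, and then many \<open>s\<close> agree on everything. The reservoir keeps at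
  least \<open>2\<^bsup>(2k+1) m\<^sup>2\<^esup>\<close> elements, where \<open>m\<close> is the current size of the parts. After \<open>r\<close> steps
  the colours of the pairs \<open>i < j\<close> contain a monochromatic complete graph on \<open>d - 1\<close> indices,
  and \<open>n\<close> elements of \<open>S\<close> form the last part.
\<close>

section \<open>Pigeonhole principle\<close>

lemma pigeonhole_large_fibre:
  assumes "finite A" "finite B" "B \<noteq> {}" "f \<in> A \<rightarrow> B" "q * card B \<le> card A"
  shows "\<exists>b\<in>B. q \<le> card {x\<in>A. f x = b}"
proof (rule ccontr)
  assume "\<not> ?thesis"
  then have small: "card {x\<in>A. f x = b} < q" if "b \<in> B" for b
    using that by force
  have "card A = (\<Sum>b\<in>B. card {x\<in>A. f x = b})"
    using sum.group[OF assms(1,2), of f "\<lambda>_. 1::nat"] assms(4)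
    by (simp add: image_subset_iff_funcset)
  also have "\<dots> < (\<Sum>b\<in>B. q)"
    using small assms(2,3) by (intro sum_strict_mono) auto
  finally show False
    using assms(5) by (simp add: mult.commute)
qed

text \<open>Trimming the fibre to exactly \<open>q\<close> elements keeps all part sizes exact, so
  the chosen subsets can be counted by binomial coefficients.\<close>

lemma pigeonhole_nsets_fibre:
  assumes "finite A" "finite B" "B \<noteq> {}" "f \<in> A \<rightarrow> B" "q * card B \<le> card A"
  shows "\<exists>b\<in>B. \<exists>C\<in>nsets A q. \<forall>x\<in>C. f x = b"
proof -
  obtain b where b: "b \<in> B" "q \<le> card {x\<in>A. f x = b}"
    using pigeonhole_large_fibre[OF assms] by blast
  obtain C where "C \<subseteq> {x\<in>A. f x = b}" "card C = q" "finite C"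
    using b(2) by (rule obtain_subset_with_card_n)
  then have "C \<in> nsets A q" "\<forall>x\<in>C. f x = b"
    by (auto simp: nsets_def)
  with b(1) show ?thesis
    by blast
qed

section \<open>Numerical estimates\<close>

text \<open>Pascal's rule makes the coefficient a sum of two entries of row \<open>n - 1\<close>,
  hence at most the sum of that row. The factor 2 saved over \<open>2 ^ n\<close> matters: the
  estimate of \<open>(m + 1) * a\<close> in \<open>reservoir_bound\<close> is an equality at
  \<open>l = 2\<close>, \<open>m = 1\<close>.\<close>

lemma binomial_le_two_power_pred:
  assumes "n \<ge> 1"
  shows "n choose k \<le> 2 ^ (n - 1)"
proof (cases k)
  case 0
  then show ?thesis by simp
next
  case (Suc j)
  obtain p where n: "n = Suc p"
    using assms by (cases n) auto
  have "n choose k = (\<Sum>i\<in>{j, Suc j}. p choose i)"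
    by (simp add: n Suc)
  also have "\<dots> = (\<Sum>i\<in>{j, Suc j} \<inter> {..p}. p choose i)"
    by (rule sum.mono_neutral_right) (auto simp: binomial_eq_0)
  also have "\<dots> \<le> (\<Sum>i\<le>p. p choose i)"
    by (rule sum_mono2) auto
  also have "\<dots> = 2 ^ p"
    by (rule choose_row_sum)
  finally show ?thesis
    by (simp add: n)
qed

lemma le_two_power_pred:
  fixes n :: nat
  assumes "n \<ge> 1"
  shows "n \<le> 2 ^ (n - 1)"
  using less_exp[of "n - 1"] assms by linarith

text \<open>The arithmetic behind one extension step: \<open>t\<close> elements are set aside, and
  the rest must fill \<open>(t choose m) * P\<close> pigeonholes, one of which is to receive the
  next reservoir. Here \<open>P\<close> stands for the number of patterns on the \<open>k\<close>
  old parts.\<close>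

lemma reservoir_bound:
  fixes k l m t P :: nat
  defines "a \<equiv> k * (l * m + l - 2)"
  assumes "l \<ge> 2" "m \<ge> 1" and t: "t = m * 2 ^ a" and P: "P \<le> 2 ^ a"
  shows "t + 2 ^ ((2*k + 3) * m\<^sup>2) * ((t choose m) * P) \<le> 2 ^ ((2*k + 1) * (l * m)\<^sup>2)"
proof -
  \<comment> \<open>The three summands are the exponents of the new reservoir size, of the bound for
    \<open>t choose m\<close>, and of the bound for \<open>P\<close>.\<close>
  define X where "X = (2*k + 3) * m\<^sup>2 + m * (m - 1 + a) + a"
  have t_le: "t \<le> 2 ^ (m - 1 + a)"
    using le_two_power_pred[OF \<open>m \<ge> 1\<close>] by (simp add: t power_add)
  have "t choose m \<le> t ^ m"
    using binomial_le_pow[of m t] by (cases "m \<le> t") (simp_all add: binomial_eq_0)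
  also have "\<dots> \<le> (2 ^ (m - 1 + a)) ^ m"
    using t_le by (rule power_mono) simp
  finally have "t choose m \<le> 2 ^ (m * (m - 1 + a))"
    by (simp add: power_mult[symmetric] mult.commute)
  then have "2 ^ ((2*k + 3) * m\<^sup>2) * ((t choose m) * P)
      \<le> 2 ^ ((2*k + 3) * m\<^sup>2) * (2 ^ (m * (m - 1 + a)) * 2 ^ a)"
    using P by (intro mult_mono) auto
  also have "\<dots> = 2 ^ X"
    by (simp add: X_def power_add)
  finally have main: "2 ^ ((2*k + 3) * m\<^sup>2) * ((t choose m) * P) \<le> 2 ^ X" .
  have "m - 1 + a \<le> m * (m - 1 + a)"
    using \<open>m \<ge> 1\<close> by simp
  then have "m - 1 + a \<le> X"
    unfolding X_def by linarith
  then have "t \<le> 2 ^ X"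
    using t_le by (meson le_trans one_le_numeral power_increasing)
  \<comment> \<open>Both summands are at most \<open>2 ^ X\<close>, so adding them costs one in the
    exponent.\<close>
  with main have sum: "t + 2 ^ ((2*k + 3) * m\<^sup>2) * ((t choose m) * P) \<le> 2 ^ (X + 1)"
    by simp
  have "X + 1 \<le> (2*k + 1) * (l * m)\<^sup>2"
  proof -
    \<comment> \<open>This is \<open>(l - 2)^2 >= 0\<close>.\<close>
    have "4 * (l - 1) \<le> l\<^sup>2"
    proof -
      obtain b where "l = b + 2"
        using \<open>l \<ge> 2\<close> by (metis le_add_diff_inverse2)
      then show ?thesis
        by (simp add: power2_eq_square)
    qed
    have "l - 2 \<le> (l - 2) * m"
      using \<open>m \<ge> 1\<close> by simp
    then have "l * m + l - 2 \<le> l * m + (l - 2) * m"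
      using \<open>l \<ge> 2\<close> by linarith
    also have "\<dots> = 2 * (l - 1) * m"
    proof -
      have "l + (l - 2) = 2 * (l - 1)"
        using \<open>l \<ge> 2\<close> by linarith
      then show ?thesis
        by (metis add_mult_distrib)
    qed
    finally have "(m + 1) * (l * m + l - 2) \<le> (2 * m) * (2 * (l - 1) * m)"
      using \<open>m \<ge> 1\<close> by (intro mult_le_mono) auto
    also have "\<dots> = 4 * (l - 1) * m\<^sup>2"
      by (simp add: power2_eq_square)
    also have "\<dots> \<le> l\<^sup>2 * m\<^sup>2"
      using \<open>4 * (l - 1) \<le> l\<^sup>2\<close> by (rule mult_le_mono1)
    finally have "k * ((m + 1) * (l * m + l - 2)) \<le> k * (l\<^sup>2 * m\<^sup>2)"
      by (rule mult_le_mono2)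
    then have a_le: "(m + 1) * a \<le> k * (l\<^sup>2 * m\<^sup>2)"
      by (simp only: a_def mult.left_commute)
    have "4 \<le> l\<^sup>2"
      using power_mono[OF \<open>l \<ge> 2\<close>, of 2] by simp
    \<comment> \<open>The target coefficient \<open>2*k + 1\<close> is split: \<open>k\<close>
      copies of \<open>(l * m)^2\<close> pay for \<open>(m + 1) * a\<close>, and
      \<open>k + 1\<close> copies pay for the rest of \<open>X + 1\<close>, which is at most
      \<open>(2*k + 4) * m^2\<close>.\<close>
    then have "(k + 1) * (4 * m\<^sup>2) \<le> (k + 1) * (l\<^sup>2 * m\<^sup>2)"
      by (intro mult_le_mono) auto
    moreover have "m * (m - 1) + 1 \<le> m\<^sup>2"
      using \<open>m \<ge> 1\<close> by (cases m) (simp_all add: power2_eq_square)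
    moreover have "X + 1 = (2*k + 3) * m\<^sup>2 + (m * (m - 1) + 1) + (m + 1) * a"
      by (simp add: X_def add_mult_distrib add_mult_distrib2)
    ultimately have "X + 1 \<le> (k + 1) * (l\<^sup>2 * m\<^sup>2) + k * (l\<^sup>2 * m\<^sup>2)"
      using a_le by (simp add: add_mult_distrib)
    also have "\<dots> = (2*k + 1) * (l * m)\<^sup>2"
      by (simp add: power_mult_distrib add_mult_distrib)
    finally show ?thesis .
  qed
  then have "(2::nat) ^ (X + 1) \<le> 2 ^ ((2*k + 1) * (l * m)\<^sup>2)"
    by (intro power_increasing) auto
  with sum show ?thesis
    by (rule le_trans)
qed

section \<open>Adding one part\<close>

text \<open>Three nested pigeonholes, over \<open>u\<close>, then \<open>w\<close>, then
  \<open>s\<close>. The function \<open>c u w s\<close> stands for the colour of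
  \<open>{u, w, s}\<close>; its range is constrained only for \<open>w \<noteq> s\<close>, since
  otherwise there is no triple to colour.\<close>

lemma extend_parts:
  fixes c :: "'b \<Rightarrow> 'b \<Rightarrow> 'b \<Rightarrow> nat"
  assumes "l \<ge> 2" "m \<ge> 1" "finite S"
    and V: "\<And>i. i < k \<Longrightarrow> finite (V i) \<and> card (V i) = l * m"
    and S: "2 ^ ((2*k + 1) * (l * m)\<^sup>2) \<le> card S"
    and c: "\<And>i u w s. \<lbrakk>i < k; u \<in> V i; w \<in> S; s \<in> S; w \<noteq> s\<rbrakk> \<Longrightarrow> c u w s < l"
  shows "\<exists>U W S' g. (\<forall>i<k. U i \<in> nsets (V i) m \<and> g i < l) \<and> W \<in> nsets S m
      \<and> S' \<subseteq> S - W \<and> 2 ^ ((2*k + 3) * m\<^sup>2) \<le> card S'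
      \<and> (\<forall>i<k. \<forall>u\<in>U i. \<forall>w\<in>W. \<forall>s\<in>S'. c u w s = g i)"
proof -
  define a where "a = k * (l * m + l - 2)"
  \<comment> \<open>Just large enough that distributing \<open>t\<close> elements among at most
    \<open>2 ^ a\<close> patterns puts \<open>m\<close> of them into one class.\<close>
  define t where "t = m * 2 ^ a"
  \<comment> \<open>A pattern records, for every old part, an \<open>m\<close>-subset and a colour.
    Extensional functions make the set of patterns finite, with a product as its
    cardinality.\<close>
  define \<Phi> where "\<Phi> = PiE {..<k} (\<lambda>i. nsets (V i) m \<times> {..<l})"
  have "finite \<Phi>"
    unfolding \<Phi>_def using V by (intro finite_PiE) (auto intro: finite_imp_finite_nsets)
  have "card \<Phi> \<le> (\<Prod>i<k. 2 ^ (l * m + l - 2))"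
  proof -
    have "(l * m choose m) * l \<le> 2 ^ (l * m - 1) * 2 ^ (l - 1)"
      using assms(1,2) by (intro mult_mono binomial_le_two_power_pred le_two_power_pred) auto
    also have "\<dots> = 2 ^ (l * m + l - 2)"
    proof -
      have "1 \<le> l * m" using assms(1,2) by simp
      then have "(l * m - 1) + (l - 1) = l * m + l - 2"
        using assms(1) by linarith
      then show ?thesis by (simp flip: power_add)
    qed
    finally show ?thesis
      unfolding \<Phi>_def card_PiE[OF finite_lessThan]
      using V by (intro prod_mono) (auto simp: card_cartesian_product)
  qed
  then have card_\<Phi>: "card \<Phi> \<le> 2 ^ a"
    by (simp add: a_def power_mult[symmetric] mult.commute)
  have bound: "t + 2 ^ ((2*k + 3) * m\<^sup>2) * ((t choose m) * card \<Phi>) \<le> card S"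
    using reservoir_bound[OF assms(1,2), of t k "card \<Phi>"] card_\<Phi> S
    unfolding t_def a_def by simp
  then obtain T where T: "T \<subseteq> S" "card T = t" "finite T"
    using obtain_subset_with_card_n[of t S] by (metis add_leD1)
  \<comment> \<open>Pigeonhole over \<open>u\<close>: among the \<open>l * m\<close> elements of
    \<open>V i\<close>, some \<open>m\<close> give the same one of \<open>l\<close> colours.\<close>
  have "\<exists>p\<in>\<Phi>. \<forall>i<k. \<forall>u\<in>fst (p i). c u w s = snd (p i)" if "w \<in> T" "s \<in> S - T" for w s
  proof -
    have "\<exists>q. q \<in> nsets (V i) m \<times> {..<l} \<and> (\<forall>u\<in>fst q. c u w s = snd q)" if "i < k" for i
    proof -
      have "(\<lambda>u. c u w s) \<in> V i \<rightarrow> {..<l}"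
        using c[OF that] \<open>w \<in> T\<close> \<open>s \<in> S - T\<close> T(1) by auto
      then have "\<exists>b\<in>{..<l}. \<exists>C\<in>nsets (V i) m. \<forall>u\<in>C. c u w s = b"
        using V[OF that] assms(1) by (intro pigeonhole_nsets_fibre) (auto simp: lessThan_empty_iff)
      then obtain b C where "b < l" "C \<in> nsets (V i) m" "\<forall>u\<in>C. c u w s = b"
        by auto
      then show ?thesis
        by (intro exI[of _ "(C, b)"]) auto
    qed
    then obtain q where q: "\<And>i. i < k \<Longrightarrow> q i \<in> nsets (V i) m \<times> {..<l}
        \<and> (\<forall>u\<in>fst (q i). c u w s = snd (q i))"
      by metis
    then show ?thesis
      by (intro bexI[of _ "restrict q {..<k}"]) (auto simp: \<Phi>_def)
  qed
  then obtain p where p: "\<And>w s. \<lbrakk>w \<in> T; s \<in> S - T\<rbrakk> \<Longrightarrow> p w s \<in> \<Phi>"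
    and p_col: "\<And>w s i u. \<lbrakk>w \<in> T; s \<in> S - T; i < k; u \<in> fst (p w s i)\<rbrakk>
                 \<Longrightarrow> c u w s = snd (p w s i)"
    by metis
  have "\<Phi> \<noteq> {}"
    unfolding \<Phi>_def PiE_eq_empty_iff using V assms(1)
    by (auto simp: nsets_eq_empty_iff lessThan_empty_iff)
  \<comment> \<open>Pigeonhole over \<open>w\<close>: for fixed \<open>s\<close>, some
    \<open>m\<close> elements of \<open>T\<close> have the same pattern.\<close>
  have "\<exists>x. x \<in> nsets T m \<times> \<Phi> \<and> (\<forall>w\<in>fst x. p w s = snd x)" if "s \<in> S - T" for s
  proof -
    have "m * card \<Phi> \<le> card T"
      using card_\<Phi> T(2) t_def by simp
    then have "\<exists>b\<in>\<Phi>. \<exists>C\<in>nsets T m. \<forall>w\<in>C. p w s = b"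
      using p that T(3) \<open>finite \<Phi>\<close> \<open>\<Phi> \<noteq> {}\<close> by (intro pigeonhole_nsets_fibre) auto
    then obtain b C where "b \<in> \<Phi>" "C \<in> nsets T m" "\<forall>w\<in>C. p w s = b"
      by auto
    then show ?thesis
      by (intro exI[of _ "(C, b)"]) auto
  qed
  then obtain x where x: "\<And>s. s \<in> S - T \<Longrightarrow> x s \<in> nsets T m \<times> \<Phi>"
    and x_eq: "\<And>s w. \<lbrakk>s \<in> S - T; w \<in> fst (x s)\<rbrakk> \<Longrightarrow> p w s = snd (x s)"
    by metis
  have "m \<le> t"
    by (simp add: t_def)
  then have "nsets T m \<noteq> {}"
    using T(2,3) by (auto simp: nsets_eq_empty_iff)
  moreover have "2 ^ ((2*k + 3) * m\<^sup>2) * card (nsets T m \<times> \<Phi>) \<le> card (S - T)"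
    using bound T \<open>finite S\<close> by (simp add: card_cartesian_product card_Diff_subset)
  \<comment> \<open>Pigeonhole over \<open>s\<close>: many \<open>s\<close> agree on both the
    \<open>m\<close>-subset of \<open>T\<close> and its common pattern. That subset becomes the new
    part \<open>W\<close>.\<close>
  ultimately have "\<exists>y\<in>nsets T m \<times> \<Phi>. \<exists>S'\<in>nsets (S - T) (2 ^ ((2*k + 3) * m\<^sup>2)). \<forall>s\<in>S'. x s = y"
    using x T(3) \<open>finite S\<close> \<open>finite \<Phi>\<close> \<open>\<Phi> \<noteq> {}\<close>
    by (intro pigeonhole_nsets_fibre) (simp_all add: finite_imp_finite_nsets)
  then obtain y S' where y: "y \<in> nsets T m \<times> \<Phi>"
    and S': "S' \<in> nsets (S - T) (2 ^ ((2*k + 3) * m\<^sup>2))" "\<forall>s\<in>S'. x s = y"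
    by blast
  obtain W \<pi> where y_eq: "y = (W, \<pi>)"
    by fastforce
  have W: "W \<in> nsets T m" and \<pi>: "\<pi> \<in> \<Phi>"
    using y y_eq by auto
  have "c u w s = snd (\<pi> i)" if "i < k" "u \<in> fst (\<pi> i)" "w \<in> W" "s \<in> S'" for i u w s
  proof -
    have s: "s \<in> S - T" "x s = (W, \<pi>)" and w: "w \<in> T"
      using S' that(3,4) W y_eq unfolding nsets_def by auto
    then have "p w s = \<pi>"
      using x_eq[of s w] that(3) by simp
    then show ?thesis
      using p_col[OF w s(1) that(1)] that(2) by simp
  qed
  moreover have "fst (\<pi> i) \<in> nsets (V i) m \<and> snd (\<pi> i) < l" if "i < k" for i
    using \<pi> that unfolding \<Phi>_def by (auto simp: PiE_iff mem_Times_iff)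
  ultimately show ?thesis
    using W S'(1) T(1)
    by (intro exI[of _ "\<lambda>i. fst (\<pi> i)"] exI[of _ W] exI[of _ S'] exI[of _ "\<lambda>i. snd (\<pi> i)"])
      (auto simp: nsets_def)
qed

section \<open>Iterating the extension\<close>

text \<open>The third vertex \<open>s\<close> ranges over \<open>S\<close> and the later parts
  together. Later parts are cut out of the reservoir, so the colour condition passes on when a part
  is added.\<close>

definition parts_reservoir ::
  "('b set \<Rightarrow> nat) \<Rightarrow> 'b set \<Rightarrow> nat \<Rightarrow> nat \<Rightarrow> nat \<Rightarrow> (nat \<Rightarrow> 'b set) \<Rightarrow> 'b set \<Rightarrow> (nat \<Rightarrow> nat \<Rightarrow> nat) \<Rightarrow> bool"
  where "parts_reservoir f A l k m V S g \<longleftrightarrow>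
    (\<forall>i<k. V i \<in> nsets (A - S) m) \<and> (\<forall>i<k. \<forall>j<i. V i \<inter> V j = {}) \<and> S \<subseteq> A \<and>
    (\<forall>j<k. \<forall>i<j. g i j < l \<and>
       (\<forall>u\<in>V i. \<forall>w\<in>V j. \<forall>s\<in>S \<union> (\<Union>h\<in>{j<..<k}. V h). f {u, w, s} = g i j))"

lemma parts_reservoirD:
  assumes "parts_reservoir f A l k m V S g"
  shows "i < k \<Longrightarrow> V i \<in> nsets (A - S) m"
    and "\<lbrakk>i < k; j < i\<rbrakk> \<Longrightarrow> V i \<inter> V j = {}"
    and "S \<subseteq> A"
    and "\<lbrakk>i < j; j < k\<rbrakk> \<Longrightarrow> g i j < l"
    and "\<lbrakk>i < j; j < k; u \<in> V i; w \<in> V j; s \<in> S \<union> (\<Union>h\<in>{j<..<k}. V h)\<rbrakk>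
      \<Longrightarrow> f {u, w, s} = g i j"
  using assms unfolding parts_reservoir_def by simp_all

text \<open>Each step divides the part size by \<open>l\<close>, so starting from
  \<open>n * l ^ r\<close> leaves exactly \<open>n\<close> after \<open>r\<close> steps.\<close>

lemma exists_parts_reservoir:
  fixes f :: "'b set \<Rightarrow> nat"
  assumes "l \<ge> 2" "n \<ge> 1" "finite A" and A: "2 ^ (l ^ (2 * r) * n\<^sup>2) \<le> card A"
    and f: "f \<in> nsets A 3 \<rightarrow> {..<l}"
    and "k \<le> r"
  shows "\<exists>V S g. parts_reservoir f A l k (n * l ^ (r - k)) V S g
      \<and> 2 ^ ((2*k + 1) * (n * l ^ (r - k))\<^sup>2) \<le> card S"
  using \<open>k \<le> r\<close>
proof (induction k)
  case 0
  \<comment> \<open>The initial reservoir is all of \<open>A\<close>; its required size is the bound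
    of the theorem.\<close>
  have "(2::nat) ^ (n * l ^ r)\<^sup>2 = 2 ^ (l ^ (2 * r) * n\<^sup>2)"
    by (simp add: power_mult_distrib power_mult[symmetric] mult.commute)
  then show ?case
    using A by (intro exI[of _ "\<lambda>_. {}"] exI[of _ A]) (auto simp: parts_reservoir_def)
next
  case (Suc k)
  define m where "m = n * l ^ (r - Suc k)"
  have "r - k = Suc (r - Suc k)"
    using Suc.prems by simp
  then have lm: "n * l ^ (r - k) = l * m"
    by (simp add: m_def)
  obtain V S g where parts: "parts_reservoir f A l k (l * m) V S g"
    and card_S: "2 ^ ((2*k + 1) * (l * m)\<^sup>2) \<le> card S"
    using Suc.IH[OF Suc_leD[OF Suc.prems]] unfolding lm by blast
  note V = parts_reservoirD(1)[OF parts] and disj = parts_reservoirD(2)[OF parts]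
    and S = parts_reservoirD(3)[OF parts] and g = parts_reservoirD(4)[OF parts]
    and col = parts_reservoirD(5)[OF parts]
  have "m \<ge> 1"
    using assms(1,2) by (simp add: m_def)
  have "finite S"
    using S \<open>finite A\<close> by (rule finite_subset)
  \<comment> \<open>Since \<open>u\<close> lies outside \<open>S\<close> and
    \<open>w \<noteq> s\<close>, the three vertices are distinct and \<open>f\<close> really colours
    the triple.\<close>
  have lt: "f {u, w, s} < l" if "i < k" "u \<in> V i" "w \<in> S" "s \<in> S" "w \<noteq> s" for i u w s
  proof -
    have "u \<in> A - S"
      using V[OF that(1)] that(2) by (auto simp: nsets_def)
    then have "{u, w, s} \<in> nsets A 3"
      using that S by (auto simp: nsets_def card_insert_if)
    then show ?thesis
      using f by auto
  qed
  have "\<exists>U W S' g. (\<forall>i<k. U i \<in> nsets (V i) m \<and> g i < l) \<and> W \<in> nsets S m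
      \<and> S' \<subseteq> S - W \<and> 2 ^ ((2*k + 3) * m\<^sup>2) \<le> card S'
      \<and> (\<forall>i<k. \<forall>u\<in>U i. \<forall>w\<in>W. \<forall>s\<in>S'. f {u, w, s} = g i)"
    using V lt by (intro extend_parts[OF assms(1) \<open>m \<ge> 1\<close> \<open>finite S\<close> _ card_S])
      (auto simp: nsets_def)
  then obtain U W S' \<gamma> where U: "\<And>i. i < k \<Longrightarrow> U i \<in> nsets (V i) m"
    and \<gamma>: "\<And>i. i < k \<Longrightarrow> \<gamma> i < l"
    and W: "W \<in> nsets S m" and S': "S' \<subseteq> S - W" "2 ^ ((2*k + 3) * m\<^sup>2) \<le> card S'"
    and new: "\<And>i u w s. \<lbrakk>i < k; u \<in> U i; w \<in> W; s \<in> S'\<rbrakk> \<Longrightarrow> f {u, w, s} = \<gamma> i"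
    by metis
  have UV: "U i \<subseteq> V i" if "i < k" for i
    using U[OF that] by (simp add: nsets_def)
  have VS: "V i \<subseteq> A - S" if "i < k" for i
    using V[OF that] by (simp add: nsets_def)
  have WS: "W \<subseteq> S"
    using W by (simp add: nsets_def)
  \<comment> \<open>The old parts shrink to \<open>U\<close>, and \<open>W\<close> becomes part
    \<open>k\<close>. Old pairs keep their colours; the pairs \<open>(i, k)\<close> get the new
    colours \<open>\<gamma> i\<close>.\<close>
  define V2 where "V2 = U(k := W)"
  define g2 where "g2 = (\<lambda>i j. if j = k then \<gamma> i else g i j)"
  have V2: "V2 i \<in> nsets (A - S') m" if "i < Suc k" for i
    using U[of i] UV[of i] VS[of i] W S' S that
    by (cases "i = k") (auto simp: V2_def nsets_def)
  have disj2: "V2 i \<inter> V2 j = {}" if "i < Suc k" "j < i" for i j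
    using UV[of i] UV[of j] VS[of j] WS disj[of i j] that
    by (cases "i = k") (auto simp: V2_def)
  have "S' \<subseteq> A"
    using S' S by auto
  have "2 ^ ((2 * Suc k + 1) * m\<^sup>2) \<le> card S'"
    using S'(2) by (simp add: numeral_eq_Suc)
  have g2: "g2 i j < l" if "j < Suc k" "i < j" for i j
    using g[of i j] \<gamma>[of i] that by (auto simp: g2_def)
  have col2: "f {u, w, s} = g2 i j"
    if "j < Suc k" "i < j" "u \<in> V2 i" "w \<in> V2 j" "s \<in> S' \<union> (\<Union>h\<in>{j<..<Suc k}. V2 h)" for i j u w s
  proof (cases "j = k")
    case True
    \<comment> \<open>No part follows part \<open>k\<close>, so the third vertex lies in
      \<open>S'\<close>, where \<open>new\<close> applies.\<close>
    moreover have "{k<..<Suc k} = {}"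
      by auto
    ultimately show ?thesis
      using that new[of i u w s] by (auto simp: V2_def g2_def)
  next
    case False
    then have j: "j < k" and u: "u \<in> V i" and w: "w \<in> V j"
      using that UV[of i] UV[of j] by (auto simp: V2_def)
    \<comment> \<open>Relative to the old structure, a vertex of \<open>S'\<close> or
      \<open>W\<close> lies in \<open>S\<close>, and a vertex of \<open>U h\<close> lies in
      \<open>V h\<close>.\<close>
    have "s \<in> S \<union> (\<Union>h\<in>{j<..<k}. V h)"
    proof (cases "s \<in> S'")
      case True
      then show ?thesis using S' by auto
    next
      case False
      then obtain h where h: "j < h" "h < Suc k" "s \<in> V2 h"
        using \<open>s \<in> S' \<union> (\<Union>h\<in>{j<..<Suc k}. V2 h)\<close> by auto
      then show ?thesis
        using WS UV[of h] by (cases "h = k") (auto simp: V2_def)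
    qed
    then show ?thesis
      using col[OF that(2) j u w] False by (simp add: g2_def)
  qed
  have "parts_reservoir f A l (Suc k) m V2 S' g2"
    unfolding parts_reservoir_def
    by (intro conjI allI impI ballI) (assumption | rule V2 disj2 \<open>S' \<subseteq> A\<close> g2 col2)+
  then show ?case
    unfolding m_def[symmetric] using \<open>2 ^ ((2 * Suc k + 1) * m\<^sup>2) \<le> card S'\<close> by blast
qed

section \<open>From coloured pairs of indices to a monochromatic copy\<close>

text \<open>\<open>partn\<close> colours unordered pairs, whereas \<open>g\<close> is controlled
  only for increasing arguments; \<open>Min\<close> and \<open>Max\<close> restore the
  order.\<close>

lemma partn_pairs_ordered:
  fixes g :: "nat \<Rightarrow> nat \<Rightarrow> nat"
  assumes "partn {..<r} q 2 {..<l}" and g: "\<And>i j. \<lbrakk>i < j; j < r\<rbrakk> \<Longrightarrow> g i j < l"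
  shows "\<exists>c<l. \<exists>M\<in>nsets {..<r} q. \<forall>i\<in>M. \<forall>j\<in>M. i < j \<longrightarrow> g i j = c"
proof -
  have "(\<lambda>e. g (Min e) (Max e)) \<in> nsets {..<r} 2 \<rightarrow> {..<l}"
  proof
    fix e assume "e \<in> nsets {..<r} 2"
    then obtain i j where "e = {i, j}" "i < j" "j < r"
      by (auto simp: nsets_def card_2_iff doubleton_eq_iff neq_iff)
    then show "g (Min e) (Max e) \<in> {..<l}"
      using g by simp
  qed
  then obtain c M where c: "c < l" and M: "M \<in> nsets {..<r} q"
    and mono: "(\<lambda>e. g (Min e) (Max e)) ` nsets M 2 \<subseteq> {c}"
    using assms(1) unfolding partn_def monochromatic_def by blast
  have "g i j = c" if "i \<in> M" "j \<in> M" "i < j" for i j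
  proof -
    have "{i, j} \<in> nsets M 2"
      using that by (auto simp: nsets_def)
    then show ?thesis
      using mono that(3) by fastforce
  qed
  then show ?thesis
    using c M by blast
qed

lemma monochromatic_copy_multipartite3:
  fixes V :: "nat \<Rightarrow> 'b set" and f :: "'b set \<Rightarrow> 'c"
  assumes I: "card I = d" "finite I"
    and V: "\<And>i. i \<in> I \<Longrightarrow> V i \<in> nsets A n"
    and disj: "\<And>i j. \<lbrakk>i \<in> I; j \<in> I; i < j\<rbrakk> \<Longrightarrow> V i \<inter> V j = {}"
    and col: "\<And>i j h u w s. \<lbrakk>i \<in> I; j \<in> I; h \<in> I; i < j; j < h; u \<in> V i; w \<in> V j; s \<in> V h\<rbrakk>
               \<Longrightarrow> f {u, w, s} = c"
  shows "monochromatic_copy (complete_multipartite3 d n) A f c"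
proof -
  obtain \<sigma> where \<sigma>: "bij_betw \<sigma> {..<d} I"
    using finite_same_card_bij[of "{..<d}" I] I by auto
  have "\<exists>h. bij_betw h {..<n} (V i)" if "i \<in> I" for i
    using finite_same_card_bij[of "{..<n}" "V i"] V[OF that] by (auto simp: nsets_def)
  then obtain h where h: "\<And>i. i \<in> I \<Longrightarrow> bij_betw (h i) {..<n} (V i)"
    by metis
  \<comment> \<open>Vertex \<open>x\<close> of part \<open>i\<close> goes to the element numbered
    \<open>x\<close> in \<open>V (\<sigma> i)\<close>.\<close>
  define \<phi> where "\<phi> = (\<lambda>(i, x). h (\<sigma> i) x)"
  have \<sigma>I: "\<sigma> i \<in> I" if "i < d" for i
    using \<sigma> that by (auto simp: bij_betw_def)
  have \<sigma>_inj: "\<sigma> i = \<sigma> j \<longleftrightarrow> i = j" if "i < d" "j < d" for i j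
    using \<sigma> that by (auto simp: bij_betw_def inj_on_def)
  have \<phi>V: "\<phi> x \<in> V (\<sigma> (fst x))" if "x \<in> {..<d} \<times> {..<n}" for x
    using h[OF \<sigma>I, of "fst x"] that
    by (auto simp: \<phi>_def intro: bij_betw_apply)
  have "inj_on \<phi> ({..<d} \<times> {..<n})"
  proof (rule inj_onI)
    fix x y assume x: "x \<in> {..<d} \<times> {..<n}" and y: "y \<in> {..<d} \<times> {..<n}" and eq: "\<phi> x = \<phi> y"
    have "\<sigma> (fst x) = \<sigma> (fst y)"
    proof (rule ccontr)
      assume "\<sigma> (fst x) \<noteq> \<sigma> (fst y)"
      then have "V (\<sigma> (fst x)) \<inter> V (\<sigma> (fst y)) = {}"
        using disj[OF \<sigma>I \<sigma>I, of "fst x" "fst y"] disj[OF \<sigma>I \<sigma>I, of "fst y" "fst x"] x y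
        by (auto simp: neq_iff)
      then show False
        using \<phi>V[OF x] \<phi>V[OF y] eq by auto
    qed
    then have fst_eq: "fst x = fst y"
      using \<sigma>_inj x y by auto
    moreover have "snd x = snd y"
      using h[OF \<sigma>I, of "fst x"] x y eq fst_eq
      by (auto simp: \<phi>_def bij_betw_def inj_on_def split: prod.splits)
    ultimately show "x = y"
      by (rule prod_eqI)
  qed
  moreover have "\<phi> ` ({..<d} \<times> {..<n}) \<subseteq> A"
    using \<phi>V V \<sigma>I by (fastforce simp: nsets_def)
  moreover have "f (\<phi> ` e) = c" if e: "e \<in> nsets ({..<d} \<times> {..<n}) 3" "inj_on fst e" for e
  proof -
    obtain x y z where xyz: "e = {x, y, z}" "x \<noteq> y" "x \<noteq> z" "y \<noteq> z"
      using e(1) by (auto simp: nsets_def card_3_iff)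
    then have mem: "x \<in> {..<d} \<times> {..<n}" "y \<in> {..<d} \<times> {..<n}" "z \<in> {..<d} \<times> {..<n}"
      using e(1) by (auto simp: nsets_def)
    have sorted: "f {\<phi> x', \<phi> y', \<phi> z'} = c"
      if "x' \<in> e" "y' \<in> e" "z' \<in> e" "\<sigma> (fst x') < \<sigma> (fst y')" "\<sigma> (fst y') < \<sigma> (fst z')" for x' y' z'
    proof -
      have "x' \<in> {..<d} \<times> {..<n}" "y' \<in> {..<d} \<times> {..<n}" "z' \<in> {..<d} \<times> {..<n}"
        using e(1) that by (auto simp: nsets_def)
      then show ?thesis
        using col[OF \<sigma>I \<sigma>I \<sigma>I that(4,5) \<phi>V \<phi>V \<phi>V] by (auto simp: mem_Times_iff)
    qed
    have "fst x \<noteq> fst y" "fst x \<noteq> fst z" "fst y \<noteq> fst z"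
      using e(2) xyz by (auto simp: inj_on_def)
    then have "\<sigma> (fst x) \<noteq> \<sigma> (fst y)" "\<sigma> (fst x) \<noteq> \<sigma> (fst z)" "\<sigma> (fst y) \<noteq> \<sigma> (fst z)"
      using \<sigma>_inj mem by (auto simp: mem_Times_iff)
    \<comment> \<open>The hypothesis \<open>col\<close> concerns increasing indices, while an edge
      is unordered. All six orders reduce to \<open>sorted\<close>, because
      \<open>{\<phi> x, \<phi> y, \<phi> z}\<close> does not depend on the listing.\<close>
    then consider
        "\<sigma> (fst x) < \<sigma> (fst y)" "\<sigma> (fst y) < \<sigma> (fst z)"
      | "\<sigma> (fst x) < \<sigma> (fst z)" "\<sigma> (fst z) < \<sigma> (fst y)"
      | "\<sigma> (fst y) < \<sigma> (fst x)" "\<sigma> (fst x) < \<sigma> (fst z)"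
      | "\<sigma> (fst y) < \<sigma> (fst z)" "\<sigma> (fst z) < \<sigma> (fst x)"
      | "\<sigma> (fst z) < \<sigma> (fst x)" "\<sigma> (fst x) < \<sigma> (fst y)"
      | "\<sigma> (fst z) < \<sigma> (fst y)" "\<sigma> (fst y) < \<sigma> (fst x)"
      by linarith
    then have "f {\<phi> x, \<phi> y, \<phi> z} = c"
    proof cases
      case 1
      then show ?thesis using sorted[of x y z] xyz(1) by simp
    next
      case 2
      then show ?thesis using sorted[of x z y] xyz(1) by (simp add: insert_commute)
    next
      case 3
      then show ?thesis using sorted[of y x z] xyz(1) by (simp add: insert_commute)
    next
      case 4
      then show ?thesis using sorted[of y z x] xyz(1) by (simp add: insert_commute)
    next
      case 5
      then show ?thesis using sorted[of z x y] xyz(1) by (simp add: insert_commute)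
    next
      case 6
      then show ?thesis using sorted[of z y x] xyz(1) by (simp add: insert_commute)
    qed
    then show ?thesis
      by (simp add: xyz(1))
  qed
  ultimately show ?thesis
    unfolding monochromatic_copy_def complete_multipartite3_def by auto
qed

section \<open>The Ramsey bound\<close>

text \<open>The colour of a triple is determined by its two smallest indices. The last part is never
  among these, so a monochromatic set of \<open>d - 1\<close> indices suffices for \<open>d\<close>
  parts.\<close>

lemma multipartite3_arrows:
  assumes "d \<ge> 1" "n \<ge> 1" "l \<ge> 2" and r: "partn {..<r} (d - 1) 2 {..<l}"
    and A: "finite A" "2 ^ (l ^ (2 * r) * n\<^sup>2) \<le> card A"
  shows "hypergraph_arrows 3 (complete_multipartite3 d n) A l"
  unfolding hypergraph_arrows_def
proof
  fix f assume f: "f \<in> nsets A 3 \<rightarrow> {..<l}"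
  obtain V S g where parts: "parts_reservoir f A l r n V S g"
    and card_S: "2 ^ ((2*r + 1) * n\<^sup>2) \<le> card S"
    using exists_parts_reservoir[OF assms(3,2) A f order_refl]
    unfolding diff_self_eq_0 power_0 mult_1_right by blast
  note V = parts_reservoirD(1)[OF parts] and disj = parts_reservoirD(2)[OF parts]
    and S = parts_reservoirD(3)[OF parts] and g = parts_reservoirD(4)[OF parts]
    and col = parts_reservoirD(5)[OF parts]
  have "\<exists>c<l. \<exists>M\<in>nsets {..<r} (d - 1). \<forall>i\<in>M. \<forall>j\<in>M. i < j \<longrightarrow> g i j = c"
    using r g by (rule partn_pairs_ordered)
  then obtain c M where "c < l" and M: "M \<in> nsets {..<r} (d - 1)"
    and mono: "\<And>i j. \<lbrakk>i \<in> M; j \<in> M; i < j\<rbrakk> \<Longrightarrow> g i j = c"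
    by blast
  have "n \<le> n\<^sup>2" and "n\<^sup>2 \<le> (2*r + 1) * n\<^sup>2"
    by (simp_all add: power2_eq_square)
  then have "n \<le> (2*r + 1) * n\<^sup>2"
    by (rule le_trans)
  also have "\<dots> < 2 ^ ((2*r + 1) * n\<^sup>2)"
    by (rule less_exp)
  finally have "n \<le> card S"
    using card_S by simp
  then obtain R where R: "R \<subseteq> S" "card R = n" "finite R"
    using obtain_subset_with_card_n by metis
  \<comment> \<open>Index \<open>r\<close> exceeds every element of \<open>M\<close>, so vertices of
    \<open>R\<close> only ever occur as the third vertex of a triple.\<close>
  define V' where "V' = V(r := R)"
  have M_less: "i < r" if "i \<in> M" for i
    using M that by (auto simp: nsets_def)
  have VS: "V i \<subseteq> A - S" if "i < r" for i
    using V[OF that] by (simp add: nsets_def)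
  have "monochromatic_copy (complete_multipartite3 d n) A f c"
  proof (rule monochromatic_copy_multipartite3[where I = "insert r M" and V = V'])
    show "finite (insert r M)" "card (insert r M) = d"
      using M M_less assms(1) by (auto simp: nsets_def card_insert_if)
    show "V' i \<in> nsets A n" if "i \<in> insert r M" for i
      using V[OF M_less, of i] R S that by (cases "i = r") (auto simp: V'_def nsets_def)
    show "V' i \<inter> V' j = {}" if "i \<in> insert r M" "j \<in> insert r M" "i < j" for i j
    proof (cases "j = r")
      case True
      then show ?thesis
        using VS[of i] M_less R(1) that by (auto simp: V'_def)
    next
      case False
      then show ?thesis
        using disj[of j i] M_less[of j] that by (auto simp: V'_def)
    qed
    show "f {u, w, s} = c"
      if "i \<in> insert r M" "j \<in> insert r M" "h \<in> insert r M" "i < j" "j < h"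
        "u \<in> V' i" "w \<in> V' j" "s \<in> V' h" for i j h u w s
    proof -
      have h: "h \<le> r"
        using that(3) M_less by (auto simp: le_less)
      then have j: "j < r" "j \<in> M" and i: "i \<in> M"
        using that by auto
      have "s \<in> S \<union> (\<Union>h\<in>{j<..<r}. V h)"
        using that(5,8) h R(1) by (cases "h = r") (auto simp: V'_def)
      then have "f {u, w, s} = g i j"
        using col[OF that(4) j(1)] that(4,6,7) j by (auto simp: V'_def)
      then show ?thesis
        using mono[OF i j(2) that(4)] by simp
    qed
  qed
  then show "\<exists>c<l. monochromatic_copy (complete_multipartite3 d n) A f c"
    using \<open>c < l\<close> by blast
qed

theorem theorem2:
  fixes d n l r :: nat
  assumes "d \<ge> 3" and "n \<ge> 1" and "l \<ge> 2"
    and "r = ramsey_number 2 (d - 1) l"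
  shows "hypergraph_ramsey 3 (complete_multipartite3 d n) l \<le> 2 ^ (l ^ (2 * r) * n\<^sup>2)"
  unfolding hypergraph_ramsey_def
proof (rule Least_le, rule multipartite3_arrows)
  show "d \<ge> 1"
    using assms(1) by simp
  show "partn {..<r} (d - 1) 2 {..<l}"
    unfolding assms(4) by (rule ramsey_number_attained)
  show "2 ^ (l ^ (2 * r) * n\<^sup>2) \<le> card {..<2 ^ (l ^ (2 * r) * n\<^sup>2) :: nat}"
    unfolding card_lessThan by (rule order_refl)
qed (rule assms finite_lessThan)+

end
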